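(* Let $S$ be a semiring and let $\Gamma \subseteq \mathrm{Ass}(S)$. If $Z(S)$ is controlled by $\Gamma$ and $\Gamma$ satisfies the prime avoidance property, then any amount $S$-semialgebra has Property (A).
   Context: A semiring is a set $S$ with operations $+,\cdot$ such that $(S,+,0)$ and $(S,\cdot,1)$ are commutative monoids with $1\neq 0$, multiplication distributes over addition, and $s\cdot 0=0$ for all $s$. An ideal of $S$ is a nonempty subset closed under addition and under multiplication by elements of $S$; $\mathrm{Id}(S)$ is the set of ideals of $S$. A proper ideal $\mathfrak p$ is prime if $ab\in\mathfrak p$ implies $a\in\mathfrak p$ or $b\in\mathfrak p$; $\mathrm{Spec}(S)$ is the set of prime ideals. $IJ$ denotes the ideal of all finite sums of products $xy$ with $x\in I$, $y\in J$; $I^0=S$. $Z(S)$ is the set of zero-divisors of $S$, i.e. of $z\in S$ with $zs=0$ for some nonzero $s\in S$ (so $0\in Z(S)$). $\mathrm{Ass}(S)$ is the set of prime ideals of $S$ of the form $\mathrm{Ann}(s)=\{t\in S: ts=0\}$ for some $s\in S$. For $\Gamma\subseteq\mathrm{Spec}(S)$: $Z(S)$ is controlled by $\Gamma$ if $Z(S)=\bigcup_{\mathfrak p\in\Gamma}\mathfrak p$; $\Gamma$ satisfies the prime avoidance property if for every ideal $I$ of $S$, $I\subseteq\bigcup_{\mathfrak p\in\Gamma}\mathfrak p$ implies $I\subseteq\mathfrak p$ for some $\mathfrak p\in\Gamma$. An $S$-semialgebra is a semiring $B$ together with a semiring morphism $\gamma: S\to B$ (preserving $+,\cdot,0,1$);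 write $sf=\gamma(s)f$. An amount function is a function $A: B\to \mathrm{Id}(S)$, $f\mapsto A_f$, such that for all $s\in S$, $f,g\in B$: (1) $A_0=(0)$ and $A_1=S$; (2) $A_f=(0)$ implies $f=0$; (3) $A_{sf}=sA_f$; (4) $A_{fg}\subseteq A_fA_g$. $B$ is an amount $S$-semialgebra if: (i) there is an amount function $A: B\to\mathrm{Id}(S)$ such that for all $f,g\in B$ there are non-negative integers $m,n$ with $A_f^mA_g^nA_{fg}=A_f^{m+1}A_g^{n+1}$; and (ii) there is a function $\epsilon:\mathrm{Id}(S)\to\mathrm{Id}(B)$, $I\mapsto I^{\epsilon}$, such that $A_f\subseteq I$ if and only if $f\in I^\epsilon$ (for all $f\in B$, $I\in \mathrm{Id}(S)$), and $I^{\epsilon}\cap S=I$ for all $I$ (where $I^\epsilon\cap S$ means $\gamma^{-1}(I^\epsilon)$). An $S$-semialgebra $B$ with amount function $A$ has Property (A) if for all $f\in B$, $A_f\subseteq Z(S)$ implies that there is a nonzero $s\in S$ with $sA_f=(0)$. *)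

theory Defs
  imports Main
begin

text \<open>
  A semiring in the sense used here (commutative, with \<open>0 \<noteq> 1\<close>) is exactly a type of class
  \<^class>\<open>comm_semiring_1\<close>. A semialgebra over \<open>'a\<close> is a type \<open>'b\<close> of this class together with a
  morphism \<open>\<gamma> :: 'a \<Rightarrow> 'b\<close>.
\<close>

definition is_ideal :: "'a::comm_semiring_1 set \<Rightarrow> bool" where
  "is_ideal I \<longleftrightarrow> I \<noteq> {} \<and> (\<forall>x\<in>I. \<forall>y\<in>I. x + y \<in> I) \<and> (\<forall>s. \<forall>x\<in>I. s * x \<in> I)"

definition is_prime_ideal :: "'a::comm_semiring_1 set \<Rightarrow> bool" where
  "is_prime_ideal P \<longleftrightarrow>
     is_ideal P \<and> P \<noteq> UNIV \<and> (\<forall>a b. a * b \<in> P \<longrightarrow> a \<in> P \<or> b \<in> P)"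

definition Spec :: "'a::comm_semiring_1 set set" where
  "Spec = {P. is_prime_ideal P}"

definition ideal_mult :: "'a::comm_semiring_1 set \<Rightarrow> 'a set \<Rightarrow> 'a set" where
  "ideal_mult I J = {(\<Sum>i<n. x i * y i) | (n::nat) x y. \<forall>i<n. x i \<in> I \<and> y i \<in> J}"

primrec ideal_power :: "'a::comm_semiring_1 set \<Rightarrow> nat \<Rightarrow> 'a set" where
  "ideal_power I 0 = UNIV"
| "ideal_power I (Suc n) = ideal_mult I (ideal_power I n)"

definition zero_divisors :: "'a::comm_semiring_1 set" where
  "zero_divisors = {z. \<exists>s. s \<noteq> 0 \<and> z * s = 0}"

definition Ann :: "'a::comm_semiring_1 \<Rightarrow> 'a set" where
  "Ann s = {t. t * s = 0}"

definition Ass :: "'a::comm_semiring_1 set set" where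
  "Ass = {P \<in> Spec. \<exists>s. P = Ann s}"

definition zero_divisors_controlled_by :: "'a::comm_semiring_1 set set \<Rightarrow> bool" where
  "zero_divisors_controlled_by \<Gamma> \<longleftrightarrow> zero_divisors = \<Union>\<Gamma>"

definition prime_avoidance :: "'a::comm_semiring_1 set set \<Rightarrow> bool" where
  "prime_avoidance \<Gamma> \<longleftrightarrow> (\<forall>I. is_ideal I \<longrightarrow> I \<subseteq> \<Union>\<Gamma> \<longrightarrow> (\<exists>P\<in>\<Gamma>. I \<subseteq> P))"

definition semiring_morphism :: "('a::comm_semiring_1 \<Rightarrow> 'b::comm_semiring_1) \<Rightarrow> bool" where
  "semiring_morphism \<gamma> \<longleftrightarrow>
     (\<forall>x y. \<gamma> (x + y) = \<gamma> x + \<gamma> y) \<and> (\<forall>x y. \<gamma> (x * y) = \<gamma> x * \<gamma> y) \<and> \<gamma> 0 = 0 \<and> \<gamma> 1 = 1"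

definition amount_function ::
    "('a::comm_semiring_1 \<Rightarrow> 'b::comm_semiring_1) \<Rightarrow> ('b \<Rightarrow> 'a set) \<Rightarrow> bool" where
  "amount_function \<gamma> A \<longleftrightarrow>
     (\<forall>f. is_ideal (A f)) \<and>
     A 0 = {0} \<and> A 1 = UNIV \<and>
     (\<forall>f. A f = {0} \<longrightarrow> f = 0) \<and>
     (\<forall>s f. A (\<gamma> s * f) = (\<lambda>t. s * t) ` A f) \<and>
     (\<forall>f g. A (f * g) \<subseteq> ideal_mult (A f) (A g))"

text \<open>
  The amount function \<open>A\<close> is kept as part of the structure, since Property (A) refers to it;
  the map \<open>\<epsilon>\<close> on ideals is only required to exist.
\<close>

definition amount_semialgebra ::
    "('a::comm_semiring_1 \<Rightarrow> 'b::comm_semiring_1) \<Rightarrow> ('b \<Rightarrow> 'a set) \<Rightarrow> bool" where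
  "amount_semialgebra \<gamma> A \<longleftrightarrow>
     semiring_morphism \<gamma> \<and>
     amount_function \<gamma> A \<and>
     (\<forall>f g. \<exists>m n.
        ideal_mult (ideal_mult (ideal_power (A f) m) (ideal_power (A g) n)) (A (f * g)) =
        ideal_mult (ideal_power (A f) (m + 1)) (ideal_power (A g) (n + 1))) \<and>
     (\<exists>\<epsilon> :: 'a set \<Rightarrow> 'b set. \<forall>I. is_ideal I \<longrightarrow>
        is_ideal (\<epsilon> I) \<and> (\<forall>f. A f \<subseteq> I \<longleftrightarrow> f \<in> \<epsilon> I) \<and> \<gamma> -` \<epsilon> I = I)"

definition property_A :: "('b::comm_semiring_1 \<Rightarrow> 'a::comm_semiring_1 set) \<Rightarrow> bool" where
  "property_A A \<longleftrightarrow>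
     (\<forall>f. A f \<subseteq> zero_divisors \<longrightarrow> (\<exists>s. s \<noteq> 0 \<and> (\<lambda>t. s * t) ` A f = {0}))"

end

theory Submission
  imports Defs
begin

text \<open>An amount inside Z(S) is an ideal covered by the primes in \<Gamma>, so prime avoidance
  puts it inside a single one of them. That prime is the annihilator of an element \<open>s\<close>,
  so one \<open>s\<close> kills the whole amount at once, where being made of zero-divisors only
  gives each element its own annihilator.\<close>

theorem theorem3p6:
  fixes \<Gamma> :: "'a::comm_semiring_1 set set"
    and \<gamma> :: "'a \<Rightarrow> 'b::comm_semiring_1"
    and A :: "'b \<Rightarrow> 'a set"
  assumes "\<Gamma> \<subseteq> Ass"
    and "zero_divisors_controlled_by \<Gamma>"
    and "prime_avoidance \<Gamma>"
    and "amount_semialgebra \<gamma> A"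
  shows "property_A A"
  unfolding property_A_def
proof (intro allI impI)
  fix f
  assume "A f \<subseteq> zero_divisors"
  moreover have ideal: "is_ideal (A f)"
    using assms(4) by (simp add: amount_semialgebra_def amount_function_def)
  ultimately obtain P where "P \<in> \<Gamma>" and sub: "A f \<subseteq> P"
    using assms(2,3) unfolding zero_divisors_controlled_by_def prime_avoidance_def by auto
  then obtain s where P: "P = Ann s" "P \<noteq> UNIV"
    using assms(1) unfolding Ass_def Spec_def is_prime_ideal_def by blast
  \<comment> \<open>\<open>Ann 0\<close> is the whole semiring, whereas \<open>P\<close> is
    proper.\<close>
  then have "s \<noteq> 0"
    by (auto simp: Ann_def)
  moreover have "s * t = 0" if "t \<in> A f" for t
    using sub P(1) that by (auto simp: Ann_def mult.commute)
  \<comment> \<open>Without this the image could be empty instead of \<open>{0}\<close>.\<close>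
  moreover have "A f \<noteq> {}"
    using ideal by (simp add: is_ideal_def)
  ultimately have "s \<noteq> 0 \<and> (\<lambda>t. s * t) ` A f = {0}"
    by auto
  then show "\<exists>s. s \<noteq> 0 \<and> (\<lambda>t. s * t) ` A f = {0}" ..
qed

end
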